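(* Let $q\in(1,2]$ and $r=\frac{q}{q-1}$. Let $f(x)=\mathbb{E}_\xi[F(x,\xi)]$ for every $x\in\mathbb{R}^n$, let $\bar F(x,\xi)=F(x,\xi)-f(x)$, and assume that for some $D_r>0$ $$\mathbb{E}_\xi\left[|\bar F(x,\xi)-\bar F(y,\xi)|^r\right]\le D_r\|x-y\|^r\qquad\text{for all }x,y\in\mathbb{R}^n .$$ Assume that the random number generator is known, i.e. different points $x$ can be sampled with the same $\xi$. Then the tail bound condition with exponent $q$ (defined in the context) can be satisfied using $O(\Delta_k^{2-2q})$ i.i.d. samples at iteration $k$: there are a function $p:(0,\infty)\to\{1,2,3,\dots\}$ with $p(\delta)=O(\delta^{2-2q})$ as $\delta\to0^+$ and a constant $\varepsilon_q>0$ such that, if for every $k$ the estimates $F_k,F_k^g$ are common-random-number sample averages (see context) with $p_k=p(\Delta_k)$ samples, then the tail bound condition with exponent $q$ holds with the constant $\varepsilon_q$.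
   Context: $f:\mathbb{R}^n\to\mathbb{R}$ is locally Lipschitz continuous with $\inf f=f^*\in\mathbb{R}$, and $F(x,\xi)$ is a stochastic oracle, where $\xi$ is a random variable that can be sampled. On a probability space, a stochastic direct-search algorithm generates, for $k=0,1,2,\dots$, random iterates $X_k\in\mathbb{R}^n$, random stepsizes $\Delta_k>0$, random directions $G_k\in\mathbb{R}^n$ with $\|G_k\|=1$, and real random variables $F_k$, $F_k^g$ which are estimates of $f(X_k)$ and $f(X_k+\Delta_kG_k)$ respectively. $\mathcal{F}_{k-1}$ is the $\sigma$-algebra generated by $(F_j,F_j^g)_{j=0}^{k-1}$ and $(G_j)_{j=0}^{k}$. $X_0$ and $\Delta_0$ are deterministic and $(X_{k+1},\Delta_{k+1})$ is determined by $(X_k,\Delta_k,G_k,F_k,F_k^g)$, so $X_k,\Delta_k,G_k$ are $\mathcal{F}_{k-1}$-measurable. Tail bound condition with exponent $q>1$: for some $\varepsilon_q>0$ (independent of $k$), for every $k$ and every $\alpha>0$, almost surely $$\mathbb{P}\left(|F_k-F_k^g-(f(X_k)-f(X_k+\Delta_kG_k))|\ge \alpha\Delta_k^q \,\middle|\, \mathcal{F}_{k-1}\right)\le \frac{\varepsilon_q}{\alpha^{q/(q-1)}} .$$ Common-random-number sample averages with $p_k$ samples: $F_k=\frac1{p_k}\sum_{i=1}^{p_k}F(X_k,\xi_{k,i})$ and $F_k^g=\frac1{p_k}\sum_{i=1}^{p_k}F(X_k+\Delta_kG_k,\xi_{k,i})$ with the same $\xi_{k,i}$, where $\xi_{k,i}$,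 $i=1,\dots,p_k$, are i.i.d. copies of $\xi$ independent of $\mathcal{F}_{k-1}$. *)

theory Defs
  imports "HOL-Probability.Probability"
begin

definition locally_lipschitz :: "('a::metric_space \<Rightarrow> 'b::metric_space) \<Rightarrow> bool" where
  "locally_lipschitz f \<longleftrightarrow> (\<forall>x. \<exists>e>0. \<exists>L. L-lipschitz_on (ball x e) f)"

text \<open>
  \<open>history M G Fe Fg k\<close> is the sigma-algebra $\mathcal{F}_{k-1}$ (note the shift of the index):
  it contains the estimates of the iterations before \<open>k\<close> and the directions up to and
  including \<open>k\<close>.
\<close>

definition history ::
  "'w measure \<Rightarrow> (nat \<Rightarrow> 'w \<Rightarrow> real^'n) \<Rightarrow> (nat \<Rightarrow> 'w \<Rightarrow> real) \<Rightarrow> (nat \<Rightarrow> 'w \<Rightarrow> real)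
    \<Rightarrow> nat \<Rightarrow> 'w measure" where
  "history M G Fe Fg k = sigma (space M)
     ({Fe j -` A \<inter> space M | j A. j < k \<and> A \<in> sets borel} \<union>
      {Fg j -` A \<inter> space M | j A. j < k \<and> A \<in> sets borel} \<union>
      {G j -` A \<inter> space M | j A. j \<le> k \<and> A \<in> sets borel})"

text \<open>
  The next iterate and stepsize are determined by the current data through a Borel map, which is
  what makes \<open>X k\<close> and \<open>\<Delta> k\<close> measurable with respect to \<open>history M G Fe Fg k\<close>.
\<close>

locale stochastic_direct_search = prob_space M
  for M :: "'w measure" +
  fixes X :: "nat \<Rightarrow> 'w \<Rightarrow> real^'n"
    and \<Delta> :: "nat \<Rightarrow> 'w \<Rightarrow> real"
    and G :: "nat \<Rightarrow> 'w \<Rightarrow> real^'n"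
    and Fe :: "nat \<Rightarrow> 'w \<Rightarrow> real"
    and Fg :: "nat \<Rightarrow> 'w \<Rightarrow> real"
  assumes measurable_G: "\<And>k. G k \<in> borel_measurable M"
    and measurable_Fe: "\<And>k. Fe k \<in> borel_measurable M"
    and measurable_Fg: "\<And>k. Fg k \<in> borel_measurable M"
    and stepsize_pos: "\<And>k \<omega>. \<omega> \<in> space M \<Longrightarrow> \<Delta> k \<omega> > 0"
    and direction_unit: "\<And>k \<omega>. \<omega> \<in> space M \<Longrightarrow> norm (G k \<omega>) = 1"
    and initial: "\<exists>x0 \<delta>0. \<forall>\<omega>\<in>space M. X 0 \<omega> = x0 \<and> \<Delta> 0 \<omega> = \<delta>0"
    and update: "\<And>k. \<exists>u \<in> borel \<rightarrow>\<^sub>M borel. \<forall>\<omega>\<in>space M.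
        (X (Suc k) \<omega>, \<Delta> (Suc k) \<omega>) = u (X k \<omega>, \<Delta> k \<omega>, G k \<omega>, Fe k \<omega>, Fg k \<omega>)"

definition tail_bound_condition ::
  "'w measure \<Rightarrow> (real^'n \<Rightarrow> real) \<Rightarrow> real \<Rightarrow> real \<Rightarrow> (nat \<Rightarrow> 'w \<Rightarrow> real^'n) \<Rightarrow> (nat \<Rightarrow> 'w \<Rightarrow> real)
    \<Rightarrow> (nat \<Rightarrow> 'w \<Rightarrow> real^'n) \<Rightarrow> (nat \<Rightarrow> 'w \<Rightarrow> real) \<Rightarrow> (nat \<Rightarrow> 'w \<Rightarrow> real) \<Rightarrow> bool" where
  "tail_bound_condition M f q \<epsilon> X \<Delta> G Fe Fg \<longleftrightarrow>
     (\<forall>k. \<forall>\<alpha>>0. AE \<omega> in M.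
        real_cond_exp M (history M G Fe Fg k)
          (indicator {\<omega> \<in> space M.
             \<bar>Fe k \<omega> - Fg k \<omega> - (f (X k \<omega>) - f (X k \<omega> + \<Delta> k \<omega> *\<^sub>R G k \<omega>))\<bar> \<ge> \<alpha> * \<Delta> k \<omega> powr q}) \<omega>
        \<le> \<epsilon> / \<alpha> powr (q / (q - 1)))"

text \<open>
  The number \<open>p (\<Delta> k \<omega>)\<close> of samples used at iteration \<open>k\<close> is itself random. Therefore every
  iteration comes with an infinite i.i.d. sequence \<open>\<xi> k 1, \<xi> k 2, \<dots>\<close> with law \<open>D\<close>, which as a
  whole sequence is independent of the past and of which the first \<open>p (\<Delta> k \<omega>)\<close> members are used.
\<close>

definition crn_sample_averages ::
  "'w measure \<Rightarrow> 's measure \<Rightarrow> (real^'n \<Rightarrow> 's \<Rightarrow> real) \<Rightarrow> (real \<Rightarrow> nat) \<Rightarrow> (nat \<Rightarrow> nat \<Rightarrow> 'w \<Rightarrow> 's)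
    \<Rightarrow> (nat \<Rightarrow> 'w \<Rightarrow> real^'n) \<Rightarrow> (nat \<Rightarrow> 'w \<Rightarrow> real)
    \<Rightarrow> (nat \<Rightarrow> 'w \<Rightarrow> real^'n) \<Rightarrow> (nat \<Rightarrow> 'w \<Rightarrow> real) \<Rightarrow> (nat \<Rightarrow> 'w \<Rightarrow> real) \<Rightarrow> bool" where
  "crn_sample_averages M D F p \<xi> X \<Delta> G Fe Fg \<longleftrightarrow>
     (\<forall>k.
        prob_space.indep_vars M (\<lambda>_. D) (\<xi> k) {1..} \<and>
        (\<forall>i\<ge>1. distr M D (\<xi> k i) = D) \<and>
        prob_space.indep_set M (sets (history M G Fe Fg k))
          (sets (vimage_algebra (space M) (\<lambda>\<omega>. \<lambda>i\<in>{1..}. \<xi> k i \<omega>) (\<Pi>\<^sub>M i\<in>{1..}. D))) \<and>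
        (\<forall>\<omega>\<in>space M.
          Fe k \<omega> = (\<Sum>i=1..p (\<Delta> k \<omega>). F (X k \<omega>) (\<xi> k i \<omega>)) / real (p (\<Delta> k \<omega>)) \<and>
          Fg k \<omega> = (\<Sum>i=1..p (\<Delta> k \<omega>). F (X k \<omega> + \<Delta> k \<omega> *\<^sub>R G k \<omega>) (\<xi> k i \<omega>)) / real (p (\<Delta> k \<omega>))))"

end

theory Submission
  imports Defs
begin

text \<open>
  Fix an iteration with iterate \<open>x\<close>, stepsize \<open>\<delta>\<close> and trial point \<open>y\<close> at distance \<open>\<delta>\<close> from \<open>x\<close>.
  Because both estimates use the same samples, the error of the estimated decrease is the average
  of \<open>n\<close> i.i.d. centred variables \<open>Fbar x \<xi> - Fbar y \<xi>\<close>, whose \<open>r\<close>-th absolute moment is at most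
  \<open>D\<^sub>r * \<delta> powr r\<close>: the common random numbers make the noise shrink with the step.

  Since \<open>q \<le> 2\<close> means \<open>r \<ge> 2\<close>, the \<open>r\<close>-th moment of a sum of \<open>n\<close> independent centred variables grows only
  like \<open>n powr (r / 2)\<close> (\<open>expectation_abs_sum_powr_le\<close>, the upper Marcinkiewicz--Zygmund inequality
  in the range \<open>r \<ge> 2\<close>), so the average has an \<open>r\<close>-th moment of order \<open>n powr (- r / 2) * \<delta> powr r\<close>.
  With \<open>n \<ge> \<delta> powr (2 - 2 * q)\<close> this is at most a constant times \<open>\<delta> powr (q * r)\<close>, and Markov's
  inequality at the level \<open>\<alpha> * \<delta> powr q\<close> cancels every power of \<open>\<delta>\<close> (\<open>stepsize_balance\<close>). What
  remains is a multiple of \<open>1 / \<alpha> powr r\<close>, which is the tail bound.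

  The moment inequality is proved by adding the variables one at a time. A second-order expansion
  of \<open>\<bar>a + b\<bar> powr r\<close> produces a linear term that vanishes in expectation by independence; Young's
  inequality with weight \<open>1 / n\<close> turns the quadratic term into a growth factor \<open>1 + 1 / n\<close>, harmless
  over \<open>n\<close> steps, and a contribution of order \<open>n powr (r / 2 - 1)\<close> per step.

  The passage from a fixed iterate to the conditional probability is the freezing lemma
  \<open>real_cond_exp_indicator_freeze\<close>: iterate, stepsize and direction are functions of the history, the
  samples are independent of it, so conditioning amounts to holding the former fixed. This also
  covers the random number of samples, which is a function of the stepsize.
\<close>

section \<open>A second-order expansion of powers of the absolute value\<close>


text \<open>
  The first two summands control large increments, where nothing cancels; the last one is the
  constant of the quadratic Taylor term after Young's inequality.
\<close>

definition moment_const :: "real \<Rightarrow> real" where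
  "moment_const r = 3 powr r + r * 2 powr r + (r\<^sup>2 * 2 powr r) powr (r / 2)"

text \<open>
  Taylor's theorem of order two at \<open>0\<close>: for \<open>\<bar>x\<bar> \<le> 1 / 2\<close> the second derivative
  \<open>r * (r - 1) * (1 + t) powr (r - 2)\<close> stays below \<open>r\<^sup>2 * 2 powr r\<close>, and the base \<open>1 + t\<close> stays positive,
  so that the power is smooth.
\<close>

lemma one_plus_powr_le_quadratic:
  fixes x r :: real
  assumes r: "r \<ge> 2" and x: "\<bar>x\<bar> \<le> 1/2"
  shows "(1 + x) powr r \<le> 1 + r * x + r\<^sup>2 * 2 powr r * x\<^sup>2"
proof (cases "x = 0")
  case False
  define diff :: "nat \<Rightarrow> real \<Rightarrow> real" where
    "diff m t = (if m = 0 then (1 + t) powr r else if m = 1 then r * (1 + t) powr (r - 1)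
                 else r * (r - 1) * (1 + t) powr (r - 2))" for m t
  have deriv: "\<forall>m t. m < 2 \<and> - (1/2) \<le> t \<and> t \<le> 1/2 \<longrightarrow> DERIV (diff m) t :> diff (Suc m) t"
  proof (intro allI impI, elim conjE)
    fix m :: nat and t :: real
    assume m: "m < 2" and t: "- (1/2) \<le> t" "t \<le> 1/2"
    then have pos: "1 + t > 0" by simp
    consider "m = 0" | "m = 1" using m by linarith
    then show "DERIV (diff m) t :> diff (Suc m) t"
    proof cases
      case 1
      then show ?thesis using pos unfolding diff_def
        by (auto intro!: derivative_eq_intros)
    next
      case 2
      then show ?thesis using pos unfolding diff_def
        by (auto intro!: derivative_eq_intros)
    qed
  qed
  have "\<exists>t. (if x < 0 then x < t \<and> t < 0 else 0 < t \<and> t < x) \<and>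
      (1 + x) powr r = (\<Sum>m<2. diff m 0 / fact m * (x - 0) ^ m) + diff 2 t / fact 2 * (x - 0) ^ 2"
    by (rule Taylor[OF _ _ deriv]) (use x False in \<open>auto simp: diff_def[of 0]\<close>)
  then obtain t where t: "if x < 0 then x < t \<and> t < 0 else 0 < t \<and> t < x"
    and eq: "(1 + x) powr r = (\<Sum>m<2. diff m 0 / fact m * x ^ m) + diff 2 t / fact 2 * x ^ 2"
    by auto
  have t': "0 < 1 + t" "1 + t \<le> 2"
    using t x by (auto split: if_splits)
  have "(1 + t) powr (r - 2) \<le> 2 powr (r - 2)"
    using t' r by (intro powr_mono2) auto
  also have "\<dots> \<le> 2 powr r" by (intro powr_mono) auto
  finally have pw: "(1 + t) powr (r - 2) \<le> 2 powr r" .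
  have "r * (r - 1) \<le> r * r" using r by (intro mult_left_mono) auto
  then have "diff 2 t \<le> r\<^sup>2 * 2 powr r"
    unfolding diff_def power2_eq_square using r pw by (auto intro!: mult_mono)
  moreover have "0 \<le> r\<^sup>2 * 2 powr r" by simp
  ultimately have "diff 2 t / 2 \<le> r\<^sup>2 * 2 powr r" by linarith
  then have "diff 2 t / 2 * x\<^sup>2 \<le> r\<^sup>2 * 2 powr r * x\<^sup>2" by (rule mult_right_mono) simp
  moreover have "(1 + x) powr r = 1 + r * x + diff 2 t / 2 * x\<^sup>2"
    using eq by (simp add: numeral_2_eq_2 diff_def)
  ultimately show ?thesis by linarith
qed simp

lemma moment_const_ge:
  assumes "r \<ge> 2"
  shows "moment_const r \<ge> 1" "moment_const r \<ge> 3 powr r + r * 2 powr r"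
    "moment_const r \<ge> (r\<^sup>2 * 2 powr r) powr (r / 2)"
proof -
  have "(3::real) powr r \<ge> 3 powr 0" using assms by (intro powr_mono) auto
  then show "moment_const r \<ge> 1" using assms unfolding moment_const_def
    by (smt (verit) mult_nonneg_nonneg powr_ge_zero powr_zero_eq_one)
qed (use assms in \<open>auto simp: moment_const_def\<close>)

text \<open>
  Young's inequality without conjugate exponents: where the left side exceeds \<open>1 / n\<close>, the factor
  \<open>n * (A * x\<^sup>2)\<close> is at least \<open>1\<close>, and multiplying by its power \<open>r / 2 - 1 \<ge> 0\<close> gives exactly the last term.
\<close>

lemma quadratic_le_young:
  fixes x r n A :: real
  assumes r: "r \<ge> 2" and n: "n > 0" and A: "A \<ge> 1"
  shows "A * x\<^sup>2 \<le> 1 / n + A powr (r / 2) * n powr (r / 2 - 1) * \<bar>x\<bar> powr r"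
proof (cases "A * x\<^sup>2 \<le> 1 / n")
  case True
  then show ?thesis by (smt (verit) mult_nonneg_nonneg powr_ge_zero)
next
  case False
  then have u: "1 \<le> n * (A * x\<^sup>2)" and x: "x \<noteq> 0" using n by (auto simp: field_simps)
  have "1 \<le> (n * (A * x\<^sup>2)) powr (r / 2 - 1)"
    using u r by (intro ge_one_powr_ge_zero) auto
  then have "A * x\<^sup>2 * 1 \<le> A * x\<^sup>2 * (n * (A * x\<^sup>2)) powr (r / 2 - 1)"
    using A by (intro mult_left_mono) auto
  also have "\<dots> = (A * x\<^sup>2) powr (r / 2) * n powr (r / 2 - 1)"
    using n A x by (simp add: powr_mult powr_diff)
  also have "(A * x\<^sup>2) powr (r / 2) = A powr (r / 2) * \<bar>x\<bar> powr r"
  proof -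
    have "(x\<^sup>2) powr (r / 2) = \<bar>x\<bar> powr r"
      using x by (metis powr_powr powr_numeral power2_abs abs_ge_zero zero_less_abs_iff
          nonzero_mult_div_cancel_left zero_neq_numeral times_divide_eq_right)
    then show ?thesis using A by (simp add: powr_mult)
  qed
  finally have "A * x\<^sup>2 \<le> A powr (r / 2) * n powr (r / 2 - 1) * \<bar>x\<bar> powr r"
    by (simp add: mult_ac)
  moreover have "0 \<le> 1 / n" using n by simp
  ultimately show ?thesis by linarith
qed

text \<open>
  This is the case \<open>a = 1\<close> of the two-variable inequality below, to which that inequality reduces by
  homogeneity. For \<open>\<bar>x\<bar> > 1 / 2\<close> no expansion is needed, since all terms are dominated by \<open>\<bar>x\<bar> powr r\<close>.
\<close>

lemma abs_one_plus_powr_le: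
  fixes x r n :: real
  assumes r: "r \<ge> 2" and n: "n \<ge> 1"
  shows "\<bar>1 + x\<bar> powr r \<le> 1 + 1 / n + r * x + moment_const r * n powr (r / 2 - 1) * \<bar>x\<bar> powr r"
proof (cases "\<bar>x\<bar> \<le> 1 / 2")
  case True
  have "1 \<le> r\<^sup>2" "1 \<le> (2::real) powr r" using r
    by (auto intro!: ge_one_powr_ge_zero one_le_power)
  then have A: "1 \<le> r\<^sup>2 * 2 powr r" by (metis mult_mono' mult_1 zero_le_one)
  have "\<bar>1 + x\<bar> = 1 + x" using True by simp
  moreover have "(r\<^sup>2 * 2 powr r) powr (r / 2) * (n powr (r / 2 - 1) * \<bar>x\<bar> powr r)
      \<le> moment_const r * (n powr (r / 2 - 1) * \<bar>x\<bar> powr r)"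
    by (intro mult_right_mono moment_const_ge r) auto
  ultimately show ?thesis
    using one_plus_powr_le_quadratic[OF r True] quadratic_le_young[OF r _ A, of n x] n
    unfolding mult.assoc by linarith
next
  case False
  have "\<bar>1 + x\<bar> powr r \<le> (3 * \<bar>x\<bar>) powr r"
    using False r by (intro powr_mono2) auto
  moreover have "- (r * x) \<le> r * 2 powr r * \<bar>x\<bar> powr r"
  proof -
    have "- x \<le> (2 * \<bar>x\<bar>) powr 1" by auto
    also have "\<dots> \<le> (2 * \<bar>x\<bar>) powr r" using False r by (intro powr_mono) auto
    finally have "r * - x \<le> r * (2 * \<bar>x\<bar>) powr r" using r by (intro mult_left_mono) auto
    then show ?thesis by (simp add: powr_mult)
  qed
  ultimately have "\<bar>1 + x\<bar> powr r - r * x \<le> (3 powr r + r * 2 powr r) * \<bar>x\<bar> powr r"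
    by (simp add: powr_mult distrib_right)
  also have "\<dots> \<le> moment_const r * \<bar>x\<bar> powr r"
    by (intro mult_right_mono moment_const_ge r) auto
  also have "\<dots> \<le> moment_const r * (n powr (r / 2 - 1) * \<bar>x\<bar> powr r)"
  proof (rule mult_left_mono)
    have "1 \<le> n powr (r / 2 - 1)" using r n by (intro ge_one_powr_ge_zero) auto
    then show "\<bar>x\<bar> powr r \<le> n powr (r / 2 - 1) * \<bar>x\<bar> powr r"
      by (metis mult_1 mult_right_mono powr_ge_zero)
    show "0 \<le> moment_const r" using moment_const_ge(1)[OF r] by simp
  qed
  finally have "\<bar>1 + x\<bar> powr r - r * x \<le> moment_const r * n powr (r / 2 - 1) * \<bar>x\<bar> powr r"
    by (simp only: mult.assoc)
  moreover have "0 \<le> 1 / n" using n by simp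
  ultimately show ?thesis by linarith
qed

text \<open>
  In the induction \<open>a\<close> is a partial sum and \<open>b\<close> the next summand. The term linear in \<open>b\<close> is kept
  exactly, because it has mean zero; an absolute value there would destroy the \<open>n powr (r / 2)\<close> growth.
  The parameter \<open>n\<close> is free and will be the final number of summands.
\<close>

lemma abs_add_powr_le:
  fixes a b r n :: real
  assumes r: "r \<ge> 2" and n: "n \<ge> 1"
  shows "\<bar>a + b\<bar> powr r \<le> (1 + 1 / n) * \<bar>a\<bar> powr r + r * (sgn a * \<bar>a\<bar> powr (r - 1) * b)
           + moment_const r * n powr (r / 2 - 1) * \<bar>b\<bar> powr r"
proof (cases "a = 0")
  case True
  have "1 \<le> n powr (r / 2 - 1)" using r n by (intro ge_one_powr_ge_zero) auto
  with moment_const_ge(1)[OF r] have "1 \<le> moment_const r * n powr (r / 2 - 1)"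
    by (metis mult_mono' mult_1 zero_le_one)
  then have "1 * \<bar>b\<bar> powr r \<le> moment_const r * n powr (r / 2 - 1) * \<bar>b\<bar> powr r"
    by (rule mult_right_mono) simp
  with True show ?thesis by simp
next
  case False
  have "\<bar>a + b\<bar> = \<bar>a\<bar> * \<bar>1 + b / a\<bar>"
    using False by (simp add: abs_mult[symmetric] field_simps)
  then have "\<bar>a + b\<bar> powr r = \<bar>a\<bar> powr r * \<bar>1 + b / a\<bar> powr r" by (simp add: powr_mult)
  also have "\<dots> \<le> \<bar>a\<bar> powr r * (1 + 1 / n + r * (b / a)
      + moment_const r * n powr (r / 2 - 1) * \<bar>b / a\<bar> powr r)"
    by (intro mult_left_mono abs_one_plus_powr_le r n) auto
  also have "\<dots> = (1 + 1 / n) * \<bar>a\<bar> powr r + r * (\<bar>a\<bar> powr r * (b / a))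
      + moment_const r * n powr (r / 2 - 1) * (\<bar>a\<bar> powr r * \<bar>b / a\<bar> powr r)"
    by (simp add: algebra_simps)
  also have "\<bar>a\<bar> powr r * \<bar>b / a\<bar> powr r = \<bar>b\<bar> powr r"
    using False by (simp add: powr_divide)
  also have "\<bar>a\<bar> powr r * (b / a) = sgn a * \<bar>a\<bar> powr (r - 1) * b"
    using False by (simp add: powr_diff sgn_real_def)
  finally show ?thesis .
qed

section \<open>Moments and tails of sums of independent centred variables\<close>

text \<open>
  Let \<open>n\<close> be the number of all summands. Adding one summand multiplies the \<open>r\<close>-th moment of the partial
  sum by at most \<open>1 + 1 / n\<close> and adds \<open>B = moment_const r * n powr (r / 2 - 1) * m\<close>. After \<open>n\<close> steps this
  gives \<open>B * n * (1 + 1 / n) ^ n\<close>, and \<open>(1 + 1 / n) ^ n \<le> exp 1\<close>.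
\<close>

lemma (in prob_space) expectation_abs_sum_powr_le:
  fixes Y :: "'i \<Rightarrow> 'a \<Rightarrow> real" and r m :: real
  assumes r: "r \<ge> 2" and I: "finite I"
    and indep: "indep_vars (\<lambda>_. borel) Y I"
    and int: "\<And>i. i \<in> I \<Longrightarrow> integrable M (Y i)"
    and mean: "\<And>i. i \<in> I \<Longrightarrow> expectation (Y i) = 0"
    and int_r: "\<And>i. i \<in> I \<Longrightarrow> integrable M (\<lambda>\<omega>. \<bar>Y i \<omega>\<bar> powr r)"
    and moment: "\<And>i. i \<in> I \<Longrightarrow> expectation (\<lambda>\<omega>. \<bar>Y i \<omega>\<bar> powr r) \<le> m"
  shows "integrable M (\<lambda>\<omega>. \<bar>\<Sum>i\<in>I. Y i \<omega>\<bar> powr r)"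
    and "expectation (\<lambda>\<omega>. \<bar>\<Sum>i\<in>I. Y i \<omega>\<bar> powr r)
           \<le> exp 1 * moment_const r * real (card I) powr (r / 2) * m"
proof -
  define n where "n = real (card I)"
  define B where "B = moment_const r * n powr (r / 2 - 1) * m"
  have "integrable M (\<lambda>\<omega>. \<bar>\<Sum>i\<in>I. Y i \<omega>\<bar> powr r) \<and>
        expectation (\<lambda>\<omega>. \<bar>\<Sum>i\<in>I. Y i \<omega>\<bar> powr r) \<le> exp 1 * moment_const r * n powr (r / 2) * m"
  proof (cases "I = {}")
    case False
    then have n: "n \<ge> 1" using I by (simp add: n_def Suc_le_eq card_gt_0_iff)
    from False obtain i0 where "i0 \<in> I" by auto
    then have "0 \<le> m" by (intro order.trans[OF Bochner_Integration.integral_nonneg moment]) auto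
    then have B: "B \<ge> 0" using moment_const_ge(1)[OF r] by (simp add: B_def)
    have "integrable M (\<lambda>\<omega>. \<bar>\<Sum>i\<in>J. Y i \<omega>\<bar> powr r) \<and>
        expectation (\<lambda>\<omega>. \<bar>\<Sum>i\<in>J. Y i \<omega>\<bar> powr r) \<le> B * (real (card J) * (1 + 1 / n) ^ card J)"
      if "J \<subseteq> I" for J
      using finite_subset[OF that I] that
    proof (induction J rule: finite_induct)
      case (insert i J)
      define S where "S \<omega> = (\<Sum>i\<in>J. Y i \<omega>)" for \<omega>
      \<comment> \<open>\<open>T\<close> is the derivative of \<open>\<bar>s\<bar> powr r / r\<close> at the partial sum; it depends on \<open>J\<close> only
        and is therefore independent of \<open>Y i\<close>.\<close>
      define T where "T \<omega> = sgn (S \<omega>) * \<bar>S \<omega>\<bar> powr (r - 1)" for \<omega>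
      have i: "i \<in> I" "J \<subseteq> I" using insert.prems by auto
      have meas_Y [measurable]: "Y j \<in> borel_measurable M" if "j \<in> I" for j
        using int[OF that] by simp
      have [measurable]: "S \<in> borel_measurable M"
        unfolding S_def using i by (intro borel_measurable_sum meas_Y) auto
      have [measurable]: "Y i \<in> borel_measurable M" using i by simp
      have IH: "integrable M (\<lambda>\<omega>. \<bar>S \<omega>\<bar> powr r)"
        "expectation (\<lambda>\<omega>. \<bar>S \<omega>\<bar> powr r) \<le> B * (real (card J) * (1 + 1 / n) ^ card J)"
        using insert.IH i unfolding S_def by auto
      have T_meas: "T \<in> borel_measurable M" unfolding T_def by measurable
      have intT: "integrable M T"
      proof (rule Bochner_Integration.integrable_bound[of M "\<lambda>\<omega>. 1 + \<bar>S \<omega>\<bar> powr r"])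
        show "AE \<omega> in M. norm (T \<omega>) \<le> norm (1 + \<bar>S \<omega>\<bar> powr r)"
        proof (rule AE_I2)
          fix \<omega>
          have "\<bar>S \<omega>\<bar> powr (r - 1) \<le> 1 + \<bar>S \<omega>\<bar> powr r"
          proof (cases "\<bar>S \<omega>\<bar> \<le> 1")
            case True
            then have "\<bar>S \<omega>\<bar> powr (r - 1) \<le> 1" using r by (intro powr_le1) auto
            then show ?thesis by (smt (verit) powr_ge_zero)
          next
            case False
            then have "\<bar>S \<omega>\<bar> powr (r - 1) \<le> \<bar>S \<omega>\<bar> powr r" by (intro powr_mono) auto
            then show ?thesis by simp
          qed
          then show "norm (T \<omega>) \<le> norm (1 + \<bar>S \<omega>\<bar> powr r)"
            by (auto simp: T_def abs_mult sgn_real_def)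
        qed
      qed (use IH T_meas in auto)
      have "indep_var borel (Y i) borel S"
        unfolding S_def using insert.hyps indep_vars_subset[OF indep insert.prems]
        by (intro indep_vars_sum) auto
      then have "indep_var borel ((\<lambda>y. y) \<circ> Y i) borel ((\<lambda>s. sgn s * \<bar>s\<bar> powr (r - 1)) \<circ> S)"
        by (rule indep_var_compose) auto
      then have indep_T: "indep_var borel (Y i) borel T"
        by (simp add: T_def[abs_def] comp_def)
      note prod = indep_var_integrable[OF indep_T int[OF i(1)] intT]
        and prod0 = indep_var_lebesgue_integral[OF indep_T int[OF i(1)] intT]
      define R where "R \<omega> = (1 + 1 / n) * \<bar>S \<omega>\<bar> powr r + r * (Y i \<omega> * T \<omega>)
           + moment_const r * n powr (r / 2 - 1) * \<bar>Y i \<omega>\<bar> powr r" for \<omega>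
      have intR: "integrable M R"
        unfolding R_def by (intro Bochner_Integration.integrable_add integrable_mult_right IH prod int_r i)
      have le: "\<bar>\<Sum>j\<in>insert i J. Y j \<omega>\<bar> powr r \<le> R \<omega>" for \<omega>
        using abs_add_powr_le[OF r n, of "S \<omega>" "Y i \<omega>"] insert.hyps
        by (simp add: R_def T_def S_def add.commute mult_ac)
      have intI: "integrable M (\<lambda>\<omega>. \<bar>\<Sum>j\<in>insert i J. Y j \<omega>\<bar> powr r)"
      proof (rule Bochner_Integration.integrable_bound[OF intR])
        show "(\<lambda>\<omega>. \<bar>\<Sum>j\<in>insert i J. Y j \<omega>\<bar> powr r) \<in> borel_measurable M"
          using insert.hyps by (simp add: S_def[symmetric])
        show "AE \<omega> in M. norm (\<bar>\<Sum>j\<in>insert i J. Y j \<omega>\<bar> powr r) \<le> norm (R \<omega>)"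
          using le by (intro AE_I2) (smt (verit) powr_ge_zero real_norm_def)
      qed
      have "expectation (\<lambda>\<omega>. \<bar>\<Sum>j\<in>insert i J. Y j \<omega>\<bar> powr r) \<le> expectation R"
        by (intro integral_mono intI intR le)
      \<comment> \<open>The linear term disappears: it is the product of the means of \<open>Y i\<close> and \<open>T\<close>.\<close>
      also have "expectation R = (1 + 1 / n) * expectation (\<lambda>\<omega>. \<bar>S \<omega>\<bar> powr r)
          + moment_const r * n powr (r / 2 - 1) * expectation (\<lambda>\<omega>. \<bar>Y i \<omega>\<bar> powr r)"
        unfolding R_def using IH(1) prod prod0 int_r[OF i(1)] mean[OF i(1)] by simp
      also have "\<dots> \<le> (1 + 1 / n) * (B * (real (card J) * (1 + 1 / n) ^ card J)) + B"
        unfolding B_def mult.assoc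
        using IH(2)[unfolded B_def mult.assoc] moment[OF i(1)] n moment_const_ge(1)[OF r]
        by (intro add_mono mult_left_mono) auto
      also have "\<dots> = B * (real (card J) * (1 + 1 / n) ^ Suc (card J) + 1)"
        by (simp add: algebra_simps)
      also have "\<dots> \<le> B * (real (card J) * (1 + 1 / n) ^ Suc (card J) + (1 + 1 / n) ^ Suc (card J))"
        using n by (intro mult_left_mono B add_left_mono one_le_power) auto
      also have "\<dots> = B * (real (card (insert i J)) * (1 + 1 / n) ^ card (insert i J))"
        using insert.hyps by (simp add: distrib_right)
      finally show ?case using intI by simp
    qed simp
    from this[of I] have I': "integrable M (\<lambda>\<omega>. \<bar>\<Sum>i\<in>I. Y i \<omega>\<bar> powr r)"
      "expectation (\<lambda>\<omega>. \<bar>\<Sum>i\<in>I. Y i \<omega>\<bar> powr r) \<le> B * (n * (1 + 1 / n) ^ card I)"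
      by (auto simp: n_def)
    note I'(2)
    also have "B * (n * (1 + 1 / n) ^ card I) \<le> B * (n * exp 1)"
    proof (intro mult_left_mono B)
      have "(1 + 1 / n) ^ card I \<le> exp (1 / n) ^ card I"
        using n by (intro power_mono exp_ge_add_one_self) auto
      also have "\<dots> = exp 1" using n by (simp add: exp_of_nat_mult[symmetric] n_def)
      finally show "(1 + 1 / n) ^ card I \<le> exp 1" .
    qed (use n in auto)
    also have "\<dots> = exp 1 * moment_const r * n powr (r / 2) * m"
      using n by (simp add: B_def powr_diff)
    finally show ?thesis using I'(1) by simp
  qed (simp add: n_def)
  then show "integrable M (\<lambda>\<omega>. \<bar>\<Sum>i\<in>I. Y i \<omega>\<bar> powr r)"
    and "expectation (\<lambda>\<omega>. \<bar>\<Sum>i\<in>I. Y i \<omega>\<bar> powr r)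
           \<le> exp 1 * moment_const r * real (card I) powr (r / 2) * m"
    by (auto simp: n_def)
qed

lemma (in prob_space) prob_abs_sum_ge_le:
  fixes Y :: "'i \<Rightarrow> 'a \<Rightarrow> real" and r m s :: real
  assumes r: "r \<ge> 2" and I: "finite I"
    and indep: "indep_vars (\<lambda>_. borel) Y I"
    and int: "\<And>i. i \<in> I \<Longrightarrow> integrable M (Y i)"
    and mean: "\<And>i. i \<in> I \<Longrightarrow> expectation (Y i) = 0"
    and int_r: "\<And>i. i \<in> I \<Longrightarrow> integrable M (\<lambda>\<omega>. \<bar>Y i \<omega>\<bar> powr r)"
    and moment: "\<And>i. i \<in> I \<Longrightarrow> expectation (\<lambda>\<omega>. \<bar>Y i \<omega>\<bar> powr r) \<le> m"
    and s: "s > 0"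
  shows "prob {\<omega> \<in> space M. \<bar>\<Sum>i\<in>I. Y i \<omega>\<bar> \<ge> s}
           \<le> exp 1 * moment_const r * real (card I) powr (r / 2) * m / s powr r"
proof -
  note mom = expectation_abs_sum_powr_le[OF r I indep int mean int_r moment]
  have "\<bar>\<Sum>i\<in>I. Y i \<omega>\<bar> \<ge> s \<longleftrightarrow> \<bar>\<Sum>i\<in>I. Y i \<omega>\<bar> powr r \<ge> s powr r" for \<omega>
    using s r powr_less_mono2[of r "\<bar>\<Sum>i\<in>I. Y i \<omega>\<bar>" s] powr_mono2[of r s "\<bar>\<Sum>i\<in>I. Y i \<omega>\<bar>"]
    by (auto simp: not_less[symmetric])
  then have "prob {\<omega> \<in> space M. \<bar>\<Sum>i\<in>I. Y i \<omega>\<bar> \<ge> s}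
      = prob {\<omega> \<in> space M. \<bar>\<Sum>i\<in>I. Y i \<omega>\<bar> powr r \<ge> s powr r}" by simp
  also have "\<dots> \<le> expectation (\<lambda>\<omega>. \<bar>\<Sum>i\<in>I. Y i \<omega>\<bar> powr r) / s powr r"
    using s by (intro integral_Markov_inequality_measure[where A = "{}"] mom) auto
  also have "\<dots> \<le> exp 1 * moment_const r * real (card I) powr (r / 2) * m / s powr r"
    by (intro divide_right_mono mom) auto
  finally show ?thesis .
qed

text \<open>
  The form for samples \<open>\<xi> i\<close> of a law \<open>D\<close>: all hypotheses on \<open>h\<close> are integrals over \<open>D\<close>, which is how the
  oracle is described.
\<close>

lemma (in prob_space) prob_abs_sum_iid_ge_le:
  fixes h :: "'b \<Rightarrow> real" and r m s :: real
  assumes r: "r \<ge> 2" and I: "finite I"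
    and indep: "indep_vars (\<lambda>_. D) \<xi> I"
    and law: "\<And>i. i \<in> I \<Longrightarrow> distr M D (\<xi> i) = D"
    and int: "integrable D h"
    and mean: "(\<integral>x. h x \<partial>D) = 0"
    and int_r: "integrable D (\<lambda>x. \<bar>h x\<bar> powr r)"
    and moment: "(\<integral>x. \<bar>h x\<bar> powr r \<partial>D) \<le> m"
    and s: "s > 0"
  shows "prob {\<omega> \<in> space M. \<bar>\<Sum>i\<in>I. h (\<xi> i \<omega>)\<bar> \<ge> s}
           \<le> exp 1 * moment_const r * real (card I) powr (r / 2) * m / s powr r"
proof (rule prob_abs_sum_ge_le[OF r I _ _ _ _ _ s])
  have h [measurable]: "h \<in> borel_measurable D" using int by simp
  show "indep_vars (\<lambda>_. borel) (\<lambda>i \<omega>. h (\<xi> i \<omega>)) I"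
    using indep_vars_compose[OF indep, of "\<lambda>_. h" "\<lambda>_. borel"] by (simp add: comp_def)
  fix i assume i: "i \<in> I"
  have \<xi> [measurable]: "\<xi> i \<in> M \<rightarrow>\<^sub>M D" using indep i by (auto simp: indep_vars_def)
  show "integrable M (\<lambda>\<omega>. h (\<xi> i \<omega>))"
    using integrable_distr[OF \<xi>, of h] law[OF i] int by simp
  show "expectation (\<lambda>\<omega>. h (\<xi> i \<omega>)) = 0"
    using integral_distr[OF \<xi> h] law[OF i] mean by simp
  show "integrable M (\<lambda>\<omega>. \<bar>h (\<xi> i \<omega>)\<bar> powr r)"
    using integrable_distr[OF \<xi>, of "\<lambda>x. \<bar>h x\<bar> powr r"] law[OF i] int_r by simp
  show "expectation (\<lambda>\<omega>. \<bar>h (\<xi> i \<omega>)\<bar> powr r) \<le> m"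
    using integral_distr[OF \<xi>, of "\<lambda>x. \<bar>h x\<bar> powr r"] law[OF i] moment by simp
qed

section \<open>Conditioning on the history with independent noise\<close>

text \<open>
  Conditionally on \<open>H\<close>, the first coordinate of the event is a constant and \<open>\<Xi>\<close> still has its
  unconditional law. The reason is Fubini's theorem: independence makes the joint law of the outcome,
  seen through \<open>H\<close>, and of \<open>\<Xi>\<close> a product measure, so integrating the section probabilities over a
  set \<open>A\<close> of \<open>H\<close> gives the probability of the event within \<open>A\<close>.
\<close>

lemma (in prob_space) real_cond_exp_indicator_freeze:
  assumes H: "subalgebra M H" and \<Xi> [measurable]: "\<Xi> \<in> M \<rightarrow>\<^sub>M N"
    and indep: "indep_set (sets H) (sets (vimage_algebra (space M) \<Xi> N))"
    and B [measurable]: "B \<in> sets (H \<Otimes>\<^sub>M N)"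
  shows "AE \<omega> in M. real_cond_exp M H (indicator {\<omega> \<in> space M. (\<omega>, \<Xi> \<omega>) \<in> B}) \<omega>
           = prob {\<omega>' \<in> space M. (\<omega>, \<Xi> \<omega>') \<in> B}"
proof -
  interpret sigma_finite_subalgebra M H
    by (intro finite_measure_subalgebra_is_sigma_finite)
      (simp add: finite_measure_subalgebra_def finite_measure_subalgebra_axioms_def H
        finite_measure_axioms)
  have spH: "space H = space M" and setsH: "sets H \<subseteq> sets M" using H by (auto simp: subalgebra_def)
  have id [measurable]: "(\<lambda>\<omega>. \<omega>) \<in> M \<rightarrow>\<^sub>M H"
    using spH setsH by (auto simp: measurable_def sets.sets_into_space Int_absorb2 subset_iff)
  \<comment> \<open>\<open>MH\<close> is the law of the identity, read as a random element of the coarser space \<open>H\<close>.\<close>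
  define MH where "MH = distr M H (\<lambda>\<omega>. \<omega>)"
  define P where "P = distr M N \<Xi>"
  interpret MH: prob_space MH unfolding MH_def by (rule prob_space_distr) simp
  interpret P: prob_space P unfolding P_def by (rule prob_space_distr) simp
  have sMH [measurable_cong]: "sets MH = sets H" by (simp add: MH_def)
  have sP [measurable_cong]: "sets P = sets N" by (simp add: P_def)
  have joint: "MH \<Otimes>\<^sub>M P = distr M (H \<Otimes>\<^sub>M N) (\<lambda>\<omega>. (\<omega>, \<Xi> \<omega>))"
  proof (rule pair_measure_eqI)
    fix A C assume "A \<in> sets MH" "C \<in> sets P"
    then have A: "A \<in> sets H" and C: "C \<in> sets N" by (simp_all add: sMH sP)
    have AM: "A \<in> sets M" using A setsH by auto
    have "\<Xi> -` C \<inter> space M \<in> sets (vimage_algebra (space M) \<Xi> N)"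
      by (rule in_vimage_algebra[OF C])
    then have "prob (A \<inter> (\<Xi> -` C \<inter> space M)) = prob A * prob (\<Xi> -` C \<inter> space M)"
      using indep A by (intro indep_setD)
    moreover have "A \<inter> (\<Xi> -` C \<inter> space M) = (\<lambda>\<omega>. (\<omega>, \<Xi> \<omega>)) -` (A \<times> C) \<inter> space M" by auto
    moreover have "(\<lambda>\<omega>. \<omega>) -` A \<inter> space M = A" using sets.sets_into_space[OF AM] by auto
    ultimately show "emeasure MH A * emeasure P C
        = emeasure (distr M (H \<Otimes>\<^sub>M N) (\<lambda>\<omega>. (\<omega>, \<Xi> \<omega>))) (A \<times> C)"
      using A C by (simp add: MH_def P_def emeasure_distr emeasure_eq_measure ennreal_mult)
  qed (simp_all add: MH.sigma_finite_measure_axioms P.sigma_finite_measure_axioms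
      sets_pair_measure_cong[OF sMH sP])
  define E where "E = {\<omega> \<in> space M. (\<omega>, \<Xi> \<omega>) \<in> B}"
  define g where "g \<omega> = measure P (Pair \<omega> -` B)" for \<omega>
  have E [measurable]: "E \<in> sets M" unfolding E_def by measurable
  have g_meas [measurable]: "g \<in> borel_measurable H"
    using P.measurable_emeasure_Pair[of B H] B unfolding g_def measure_def
    by (simp add: sets_pair_measure_cong[OF refl sP])
  have g_meas' [measurable]: "g \<in> borel_measurable M" by (rule measurable_from_subalg[OF H g_meas])
  have g_eq: "g \<omega> = prob {\<omega>' \<in> space M. (\<omega>, \<Xi> \<omega>') \<in> B}" for \<omega>
    unfolding g_def P_def
    by (subst measure_distr) (auto intro!: arg_cong[where f = prob] sets_Pair1[OF B])
  have intg: "integrable M g"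
    by (rule integrable_const_bound[where B = 1]) (auto simp: g_def)
  have inte: "integrable M (indicator E :: _ \<Rightarrow> real)"
    by (rule integrable_const_bound[where B = 1]) (auto simp: indicator_def)
  have "AE \<omega> in M. real_cond_exp M H (indicator E) \<omega> = g \<omega>"
  proof (rule real_cond_exp_charact[OF _ inte intg g_meas])
    fix A assume A: "A \<in> sets H"
    then have AM [measurable]: "A \<in> sets M" using setsH by auto
    define C where "C = B \<inter> (A \<times> space N)"
    have C: "C \<in> sets (H \<Otimes>\<^sub>M N)" unfolding C_def using A B by auto
    have Cx: "emeasure P (Pair \<omega> -` C) = ennreal (indicator A \<omega> * g \<omega>)" for \<omega>
    proof -
      have "Pair \<omega> -` C = (if \<omega> \<in> A then Pair \<omega> -` B else {})"
        using sets.sets_into_space[OF B] by (auto simp: C_def space_pair_measure)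
      then show ?thesis by (auto simp: g_def P.emeasure_eq_measure)
    qed
    have "ennreal (prob (E \<inter> A)) = emeasure M (E \<inter> A)" by (simp add: emeasure_eq_measure)
    also have EA: "E \<inter> A = (\<lambda>\<omega>. (\<omega>, \<Xi> \<omega>)) -` C \<inter> space M"
      using measurable_space[OF \<Xi>] sets.sets_into_space[OF AM] by (auto simp: C_def E_def)
    also have "emeasure M ((\<lambda>\<omega>. (\<omega>, \<Xi> \<omega>)) -` C \<inter> space M) = emeasure (MH \<Otimes>\<^sub>M P) C"
      unfolding joint by (rule emeasure_distr[symmetric]) (use C in auto)
    also have "\<dots> = (\<integral>\<^sup>+\<omega>. emeasure P (Pair \<omega> -` C) \<partial>MH)"
      using C by (intro P.emeasure_pair_measure_alt) (simp add: sets_pair_measure_cong[OF sMH sP])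
    also have "\<dots> = (\<integral>\<^sup>+\<omega>. ennreal (indicator A \<omega> * g \<omega>) \<partial>M)"
      unfolding Cx MH_def using A by (intro nn_integral_distr) auto
    also have "\<dots> = ennreal (\<integral>\<omega>. indicator A \<omega> * g \<omega> \<partial>M)"
      using integrable_real_mult_indicator[OF AM intg]
      by (intro nn_integral_eq_integral) (auto simp: g_def mult.commute)
    finally have "prob (E \<inter> A) = (\<integral>\<omega>. indicator A \<omega> * g \<omega> \<partial>M)"
      by (subst (asm) ennreal_inj)
        (auto simp: g_def EA[symmetric] intro!: Bochner_Integration.integral_nonneg)
    then show "(LINT \<omega>:A|M. indicator E \<omega>) = (LINT \<omega>:A|M. g \<omega>)"
      by (simp add: set_lebesgue_integral_def indicator_inter_arith[symmetric] Int_commute)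
  qed
  then show ?thesis unfolding g_eq E_def .
qed

section \<open>Measurability of the iterates\<close>

context stochastic_direct_search
begin

lemma subalgebra_history: "subalgebra M (history M G Fe Fg k)"
proof -
  let ?S = "{Fe j -` A \<inter> space M | j A. j < k \<and> A \<in> sets borel} \<union>
      {Fg j -` A \<inter> space M | j A. j < k \<and> A \<in> sets borel} \<union>
      {G j -` A \<inter> space M | j A. j \<le> k \<and> A \<in> sets borel}"
  have "?S \<subseteq> sets M"
    using measurable_Fe measurable_Fg measurable_G by (auto intro: measurable_sets)
  moreover from this have "?S \<subseteq> Pow (space M)" using sets.space_closed by blast
  ultimately show ?thesis
    unfolding subalgebra_def history_def
    using sets.sigma_sets_subset[of ?S M] by (simp add: sets_measure_of space_measure_of)
qed

lemma space_history: "space (history M G Fe Fg k) = space M"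
  using subalgebra_history by (simp add: subalgebra_def)

lemma sets_history: "sets (history M G Fe Fg k) = sigma_sets (space M)
     ({Fe j -` A \<inter> space M | j A. j < k \<and> A \<in> sets borel} \<union>
      {Fg j -` A \<inter> space M | j A. j < k \<and> A \<in> sets borel} \<union>
      {G j -` A \<inter> space M | j A. j \<le> k \<and> A \<in> sets borel})"
  unfolding history_def by (rule sets_measure_of) auto

lemma history_measurable_data:
  shows "j < k \<Longrightarrow> Fe j \<in> borel_measurable (history M G Fe Fg k)"
    and "j < k \<Longrightarrow> Fg j \<in> borel_measurable (history M G Fe Fg k)"
    and "j \<le> k \<Longrightarrow> G j \<in> borel_measurable (history M G Fe Fg k)"
proof -
  show "Fe j \<in> borel_measurable (history M G Fe Fg k)" if "j < k"
    by (rule measurableI; (simp only: space_history sets_history)?)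
      (use that in \<open>auto intro!: sigma_sets.Basic exI[of _ j]\<close>)
  show "Fg j \<in> borel_measurable (history M G Fe Fg k)" if "j < k"
    by (rule measurableI; (simp only: space_history sets_history)?)
      (use that in \<open>auto intro!: sigma_sets.Basic exI[of _ j]\<close>)
  show "G j \<in> borel_measurable (history M G Fe Fg k)" if "j \<le> k"
    by (rule measurableI; (simp only: space_history sets_history)?)
      (use that in \<open>auto intro!: sigma_sets.Basic exI[of _ j]\<close>)
qed

lemma sets_history_Suc: "sets (history M G Fe Fg k) \<subseteq> sets (history M G Fe Fg (Suc k))"
proof -
  have "{Fe j -` A \<inter> space M | j A. j < k \<and> A \<in> sets borel} \<subseteq>
        {Fe j -` A \<inter> space M | j A. j < Suc k \<and> A \<in> sets borel}"
    and "{Fg j -` A \<inter> space M | j A. j < k \<and> A \<in> sets borel} \<subseteq>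
        {Fg j -` A \<inter> space M | j A. j < Suc k \<and> A \<in> sets borel}"
    and "{G j -` A \<inter> space M | j A. j \<le> k \<and> A \<in> sets borel} \<subseteq>
        {G j -` A \<inter> space M | j A. j \<le> Suc k \<and> A \<in> sets borel}"
    using less_SucI le_SucI by blast+
  then show ?thesis unfolding sets_history by (intro sigma_sets_mono' Un_mono)
qed

text \<open>
  The history of iteration \<open>k + 1\<close> contains all arguments of the update map of iteration \<open>k\<close>, and the
  start is deterministic; the claim follows by induction along the iterations.
\<close>

lemma history_measurable_iterate:
  "X k \<in> borel_measurable (history M G Fe Fg k)"
  "\<Delta> k \<in> borel_measurable (history M G Fe Fg k)"
proof (induction k)
  case 0
  obtain x0 \<delta>0 where init: "\<forall>\<omega>\<in>space M. X 0 \<omega> = x0 \<and> \<Delta> 0 \<omega> = \<delta>0" using initial by auto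
  case 1 show ?case
    by (rule measurable_cong[THEN iffD2, of _ _ "\<lambda>_. x0"]) (use init in \<open>auto simp: space_history\<close>)
  case 2 show ?case
    by (rule measurable_cong[THEN iffD2, of _ _ "\<lambda>_. \<delta>0"]) (use init in \<open>auto simp: space_history\<close>)
next
  case (Suc k)
  let ?H = "history M G Fe Fg (Suc k)"
  have sub: "subalgebra ?H (history M G Fe Fg k)"
    using sets_history_Suc by (simp add: subalgebra_def space_history)
  have [measurable]: "X k \<in> borel_measurable ?H" "\<Delta> k \<in> borel_measurable ?H"
    using Suc.IH by (auto intro: measurable_from_subalg[OF sub])
  note [measurable] = history_measurable_data(1,2)[OF lessI]
    history_measurable_data(3)[OF le_SucI[OF order_refl]]
  obtain u where u: "u \<in> borel \<rightarrow>\<^sub>M borel"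
    "\<And>\<omega>. \<omega> \<in> space M \<Longrightarrow> (X (Suc k) \<omega>, \<Delta> (Suc k) \<omega>) = u (X k \<omega>, \<Delta> k \<omega>, G k \<omega>, Fe k \<omega>, Fg k \<omega>)"
    using update[of k] by auto
  have "(\<lambda>\<omega>. (X k \<omega>, \<Delta> k \<omega>, G k \<omega>, Fe k \<omega>, Fg k \<omega>)) \<in> borel_measurable ?H"
    by (intro borel_measurable_Pair) measurable
  from measurable_compose[OF this u(1)]
  have "(\<lambda>\<omega>. (X (Suc k) \<omega>, \<Delta> (Suc k) \<omega>)) \<in> borel_measurable ?H"
    by (rule measurable_cong[THEN iffD1, rotated]) (simp add: u(2) space_history)
  then have pair: "(\<lambda>\<omega>. (X (Suc k) \<omega>, \<Delta> (Suc k) \<omega>)) \<in> ?H \<rightarrow>\<^sub>M borel \<Otimes>\<^sub>M borel"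
    by (simp add: borel_prod)
  case 1 show ?case using measurable_compose[OF pair measurable_fst] by simp
  case 2 show ?case using measurable_compose[OF pair measurable_snd] by simp
qed

end

section \<open>The number of samples\<close>

text \<open>
  The exponent \<open>2 - 2 * q\<close> is what makes the powers of \<open>\<delta>\<close> balance: raised to \<open>r / 2\<close> and multiplied by
  the \<open>\<delta> powr (q * r)\<close> from the threshold, it gives the \<open>\<delta> powr r\<close> of the moment bound.
\<close>

lemma stepsize_balance:
  fixes \<delta> \<alpha> n q r :: real
  assumes pos: "\<delta> > 0" "\<alpha> > 0" "n > 0" and r: "r \<ge> 0" and n: "n \<ge> \<delta> powr (2 - 2 * q)"
  shows "n powr (r / 2) * \<delta> powr r / (n * (\<alpha> * \<delta> powr q)) powr r \<le> 1 / \<alpha> powr r"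
proof -
  have "\<delta> powr r = (\<delta> powr (2 - 2 * q)) powr (r / 2) * \<delta> powr (q * r)"
    by (simp add: powr_powr powr_add[symmetric] algebra_simps diff_divide_distrib)
  also have "\<dots> \<le> n powr (r / 2) * \<delta> powr (q * r)"
    using n r by (intro mult_right_mono powr_mono2) auto
  finally have "n powr (r / 2) * \<delta> powr r \<le> n powr (r / 2) * (n powr (r / 2) * \<delta> powr (q * r))"
    by (intro mult_left_mono) auto
  also have "\<dots> = n powr r * \<delta> powr (q * r)"
    by (simp add: powr_add[symmetric] mult.assoc[symmetric])
  finally have le: "n powr (r / 2) * \<delta> powr r \<le> n powr r * \<delta> powr (q * r)" .
  have "(n * (\<alpha> * \<delta> powr q)) powr r = n powr r * \<delta> powr (q * r) * \<alpha> powr r"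
    using pos by (simp add: powr_mult powr_powr)
  then show ?thesis using le pos by (simp add: field_simps)
qed

definition sample_size :: "real \<Rightarrow> real \<Rightarrow> nat" where
  "sample_size q \<delta> = nat \<lceil>\<delta> powr (2 - 2 * q)\<rceil>"

lemma sample_size_ge: "\<delta> powr (2 - 2 * q) \<le> real (sample_size q \<delta>)"
  unfolding sample_size_def by linarith

lemma sample_size_pos:
  assumes "\<delta> > 0"
  shows "sample_size q \<delta> \<ge> 1"
proof -
  have "0 < \<delta> powr (2 - 2 * q)" using assms by simp
  then have "0 < real (sample_size q \<delta>)" using sample_size_ge by (rule less_le_trans)
  then show ?thesis by simp
qed

lemma measurable_sample_size [measurable]: "sample_size q \<in> borel \<rightarrow>\<^sub>M count_space UNIV"
  unfolding sample_size_def by measurable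

text \<open>
  Rounding up at most doubles the value once it is at least \<open>1\<close>, that is, for stepsizes below \<open>1\<close>.
\<close>

lemma sample_size_bigo:
  assumes "q > 1"
  shows "(\<lambda>\<delta>. real (sample_size q \<delta>)) \<in> O[at_right 0](\<lambda>\<delta>. \<delta> powr (2 - 2 * q))"
proof (rule bigoI[where c = 2])
  have "eventually (\<lambda>\<delta>::real. 0 < \<delta> \<and> \<delta> < 1) (at_right 0)"
    by (simp add: eventually_at_right_field) (use zero_less_one in blast)
  then show "eventually (\<lambda>\<delta>. norm (real (sample_size q \<delta>)) \<le> 2 * norm (\<delta> powr (2 - 2 * q))) (at_right 0)"
  proof eventually_elim
    case (elim \<delta>)
    have "\<delta> powr 0 \<le> \<delta> powr (2 - 2 * q)"
      using elim assms by (intro powr_mono') auto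
    then have "1 \<le> \<delta> powr (2 - 2 * q)" using elim by simp
    then show ?case unfolding sample_size_def by simp linarith
  qed
qed

section \<open>The tail bound condition\<close>

theorem theorem2p8:
  fixes f :: "real^'n \<Rightarrow> real"
    and F Fbar :: "real^'n \<Rightarrow> 's \<Rightarrow> real"
    and D :: "'s measure"
    and q r D\<^sub>r fstar :: real
  assumes "locally_lipschitz f"
    and "bdd_below (range f)" and "(INF x. f x) = fstar"
    and "prob_space D"
    and "(\<lambda>(x, s). F x s) \<in> borel_measurable (borel \<Otimes>\<^sub>M D)"
    and "1 < q" and "q \<le> 2" and "r = q / (q - 1)"
    and "\<And>x. integrable D (F x)"
    and "\<And>x. f x = (LINT s|D. F x s)"
    and "\<And>x s. Fbar x s = F x s - f x"
    and "D\<^sub>r > 0"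
    and "\<And>x y. integrable D (\<lambda>s. \<bar>Fbar x s - Fbar y s\<bar> powr r)"
    and "\<And>x y. (LINT s|D. \<bar>Fbar x s - Fbar y s\<bar> powr r) \<le> D\<^sub>r * norm (x - y) powr r"
  shows "\<exists>(p :: real \<Rightarrow> nat) (\<epsilon>\<^sub>q :: real).
    (\<forall>\<delta>>0. p \<delta> \<ge> 1) \<and>
    p \<in> borel \<rightarrow>\<^sub>M count_space UNIV \<and>
    (\<lambda>\<delta>. real (p \<delta>)) \<in> O[at_right 0](\<lambda>\<delta>. \<delta> powr (2 - 2 * q)) \<and>
    \<epsilon>\<^sub>q > 0 \<and>
    (\<forall>(M :: 'w measure) X \<Delta> G Fe Fg \<xi>.
       stochastic_direct_search M X \<Delta> G Fe Fg \<longrightarrow>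
       crn_sample_averages M D F p \<xi> X \<Delta> G Fe Fg \<longrightarrow>
       tail_bound_condition M f q \<epsilon>\<^sub>q X \<Delta> G Fe Fg)"
proof -
  interpret D: prob_space D by fact
  define p where "p = sample_size q"
  define \<epsilon> where "\<epsilon> = exp 1 * moment_const r * D\<^sub>r"
  have r2: "r \<ge> 2" using \<open>1 < q\<close> \<open>q \<le> 2\<close> \<open>r = q / (q - 1)\<close> by (simp add: le_divide_eq)
  have \<epsilon>: "\<epsilon> > 0" using moment_const_ge(1)[OF r2] \<open>D\<^sub>r > 0\<close> by (simp add: \<epsilon>_def)
  have F_meas: "(\<lambda>u. F (a u) (b u)) \<in> borel_measurable S"
    if "a \<in> borel_measurable S" "b \<in> S \<rightarrow>\<^sub>M D" for S :: "'u measure" and a b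
    using measurable_compose[OF measurable_Pair[OF that] assms(5)] by simp
  have f_meas [measurable]: "f \<in> borel_measurable borel"
    using D.borel_measurable_lebesgue_integral[OF assms(5)] by (simp add: assms(10)[symmetric])
  have tail: "tail_bound_condition M f q \<epsilon> X \<Delta> G Fe Fg"
    if sds: "stochastic_direct_search M X \<Delta> G Fe Fg"
      and crn: "crn_sample_averages M D F p \<xi> X \<Delta> G Fe Fg"
    for M :: "'w measure" and X \<Delta> G Fe Fg \<xi>
    unfolding tail_bound_condition_def
  proof (intro allI impI)
    fix k :: nat and \<alpha> :: real assume \<alpha>: "\<alpha> > 0"
    interpret stochastic_direct_search M X \<Delta> G Fe Fg by fact
    let ?H = "history M G Fe Fg k"
    define N where "N = (\<Pi>\<^sub>M i\<in>{1::nat..}. D)"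
    define \<Xi> where "\<Xi> \<omega> = (\<lambda>i\<in>{1..}. \<xi> k i \<omega>)" for \<omega>
    \<comment> \<open>\<open>Err \<omega> z\<close> is the error made from the state reached in \<open>\<omega>\<close> with the samples \<open>z\<close>; separating the two
      arguments is what the freezing lemma needs.\<close>
    define Err where "Err \<omega> z = (\<Sum>i=1..p (\<Delta> k \<omega>). F (X k \<omega>) (z i)) / real (p (\<Delta> k \<omega>))
        - (\<Sum>i=1..p (\<Delta> k \<omega>). F (X k \<omega> + \<Delta> k \<omega> *\<^sub>R G k \<omega>) (z i)) / real (p (\<Delta> k \<omega>))
        - (f (X k \<omega>) - f (X k \<omega> + \<Delta> k \<omega> *\<^sub>R G k \<omega>))" for \<omega> and z :: "nat \<Rightarrow> 's"
    define B where "B = {u \<in> space (?H \<Otimes>\<^sub>M N). \<bar>Err (fst u) (snd u)\<bar> \<ge> \<alpha> * \<Delta> k (fst u) powr q}"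
    have indep: "indep_vars (\<lambda>_. D) (\<xi> k) {1..}"
      and law: "\<And>i. i \<ge> 1 \<Longrightarrow> distr M D (\<xi> k i) = D"
      and indep_hist: "indep_set (sets ?H) (sets (vimage_algebra (space M) \<Xi> N))"
      and Fe: "\<And>\<omega>. \<omega> \<in> space M \<Longrightarrow>
        Fe k \<omega> = (\<Sum>i=1..p (\<Delta> k \<omega>). F (X k \<omega>) (\<xi> k i \<omega>)) / real (p (\<Delta> k \<omega>))"
      and Fg: "\<And>\<omega>. \<omega> \<in> space M \<Longrightarrow>
        Fg k \<omega> = (\<Sum>i=1..p (\<Delta> k \<omega>). F (X k \<omega> + \<Delta> k \<omega> *\<^sub>R G k \<omega>) (\<xi> k i \<omega>)) / real (p (\<Delta> k \<omega>))"
      using crn unfolding crn_sample_averages_def \<Xi>_def N_def by blast+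
    have \<Xi>: "\<Xi> \<in> M \<rightarrow>\<^sub>M N"
      using indep unfolding \<Xi>_def N_def indep_vars_def by (intro measurable_restrict) auto
    note [measurable] = history_measurable_iterate[of k] history_measurable_data(3)[OF order_refl, of k]
    have p_meas [measurable]: "p \<in> borel \<rightarrow>\<^sub>M count_space UNIV" unfolding p_def by measurable
    have comp: "(\<lambda>u. snd u i) \<in> ?H \<Otimes>\<^sub>M N \<rightarrow>\<^sub>M D" if "i \<in> {1..n}" for i n
      using that unfolding N_def
      by (intro measurable_compose[OF measurable_snd] measurable_component_singleton) auto
    \<comment> \<open>The upper summation limit is random but takes countably many values.\<close>
    have avg: "(\<lambda>u. (\<Sum>i=1..p (\<Delta> k (fst u)). F (a (fst u)) (snd u i)) / real (p (\<Delta> k (fst u))))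
        \<in> borel_measurable (?H \<Otimes>\<^sub>M N)" if [measurable]: "a \<in> borel_measurable ?H" for a
    proof (rule measurable_compose_countable
        [where f = "\<lambda>n u. (\<Sum>i=1..n. F (a (fst u)) (snd u i)) / real n" and g = "\<lambda>u. p (\<Delta> k (fst u))"])
      show "(\<lambda>u. (\<Sum>i=1..n. F (a (fst u)) (snd u i)) / real n) \<in> borel_measurable (?H \<Otimes>\<^sub>M N)" for n
        by (intro borel_measurable_divide borel_measurable_sum F_meas comp) auto
    qed measurable
    have [measurable]: "(\<lambda>u. Err (fst u) (snd u)) \<in> borel_measurable (?H \<Otimes>\<^sub>M N)"
      unfolding Err_def by (intro borel_measurable_diff avg) measurable
    have B: "B \<in> sets (?H \<Otimes>\<^sub>M N)"
      unfolding B_def by measurable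
    have Err_eq: "\<bar>Fe k \<omega> - Fg k \<omega> - (f (X k \<omega>) - f (X k \<omega> + \<Delta> k \<omega> *\<^sub>R G k \<omega>))\<bar> = \<bar>Err \<omega> (\<Xi> \<omega>)\<bar>"
      if "\<omega> \<in> space M" for \<omega>
      using that by (simp add: Err_def Fe Fg \<Xi>_def)
    have in_B: "(\<omega>, \<Xi> \<omega>') \<in> B \<longleftrightarrow> \<bar>Err \<omega> (\<Xi> \<omega>')\<bar> \<ge> \<alpha> * \<Delta> k \<omega> powr q"
      if "\<omega> \<in> space M" "\<omega>' \<in> space M" for \<omega> \<omega>'
      using that measurable_space[OF \<Xi>] by (simp add: B_def space_pair_measure space_history)
    have bound: "prob {\<omega>' \<in> space M. (\<omega>, \<Xi> \<omega>') \<in> B} \<le> \<epsilon> / \<alpha> powr r"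
      if \<omega>: "\<omega> \<in> space M" for \<omega>
    proof -
      define \<delta> x y n where "\<delta> = \<Delta> k \<omega>" and "x = X k \<omega>" and "y = X k \<omega> + \<Delta> k \<omega> *\<^sub>R G k \<omega>"
        and "n = p \<delta>"
      define h where "h s = Fbar x s - Fbar y s" for s
      have \<delta>: "\<delta> > 0" using stepsize_pos[OF \<omega>] by (simp add: \<delta>_def)
      have xy: "norm (x - y) = \<delta>"
        using direction_unit[OF \<omega>] \<delta> by (simp add: x_def y_def \<delta>_def)
      have n: "n \<ge> 1" "real n \<ge> \<delta> powr (2 - 2 * q)"
        using sample_size_pos[OF \<delta>] sample_size_ge by (auto simp: n_def p_def)
      have "\<bar>Err \<omega> (\<Xi> \<omega>')\<bar> = \<bar>\<Sum>i=1..n. h (\<xi> k i \<omega>')\<bar> / real n" for \<omega>'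
      proof -
        have "(\<Sum>i=1..n. h (\<xi> k i \<omega>'))
            = (\<Sum>i=1..n. F x (\<xi> k i \<omega>')) - (\<Sum>i=1..n. F y (\<xi> k i \<omega>')) - real n * (f x - f y)"
          unfolding h_def assms(11) sum_subtractf by (simp add: right_diff_distrib)
        moreover have "Err \<omega> (\<Xi> \<omega>') = (\<Sum>i=1..n. F x (\<xi> k i \<omega>')) / real n
            - (\<Sum>i=1..n. F y (\<xi> k i \<omega>')) / real n - (f x - f y)"
          by (simp add: Err_def \<Xi>_def x_def y_def n_def \<delta>_def)
        ultimately have "Err \<omega> (\<Xi> \<omega>') = (\<Sum>i=1..n. h (\<xi> k i \<omega>')) / real n"
          using n(1) by (simp add: diff_divide_distrib)
        then show ?thesis by simp
      qed
      then have "(\<omega>, \<Xi> \<omega>') \<in> B \<longleftrightarrow> \<bar>\<Sum>i=1..n. h (\<xi> k i \<omega>')\<bar> \<ge> real n * (\<alpha> * \<delta> powr q)"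
        if "\<omega>' \<in> space M" for \<omega>'
        using n(1) in_B[OF \<omega> that] unfolding \<delta>_def by (simp add: le_divide_eq mult.commute)
      then have "{\<omega>' \<in> space M. (\<omega>, \<Xi> \<omega>') \<in> B}
          = {\<omega>' \<in> space M. \<bar>\<Sum>i=1..n. h (\<xi> k i \<omega>')\<bar> \<ge> real n * (\<alpha> * \<delta> powr q)}"
        by blast
      also have "prob \<dots> \<le> exp 1 * moment_const r * real (card {1..n}) powr (r / 2) * (D\<^sub>r * \<delta> powr r)
          / (real n * (\<alpha> * \<delta> powr q)) powr r"
      proof (rule prob_abs_sum_iid_ge_le[OF r2, where h = h and D = D and \<xi> = "\<xi> k"])
        show "indep_vars (\<lambda>_. D) (\<xi> k) {1..n}" by (rule indep_vars_subset[OF indep]) auto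
        show "integrable D h" unfolding h_def assms(11) using assms(9) by simp
        show "(LINT s|D. h s) = 0"
          unfolding h_def assms(11) using assms(9) D.prob_space by (simp flip: assms(10))
        show "integrable D (\<lambda>s. \<bar>h s\<bar> powr r)" unfolding h_def by (rule assms(13))
        show "(LINT s|D. \<bar>h s\<bar> powr r) \<le> D\<^sub>r * \<delta> powr r"
          unfolding h_def xy[symmetric] by (rule assms(14))
      qed (use law n \<alpha> \<delta> in auto)
      also have "\<dots> = \<epsilon> * (real n powr (r / 2) * \<delta> powr r / (real n * (\<alpha> * \<delta> powr q)) powr r)"
        by (simp add: \<epsilon>_def mult_ac)
      also have "\<dots> \<le> \<epsilon> * (1 / \<alpha> powr r)"
        using stepsize_balance[of \<delta> \<alpha> "real n" r q] \<delta> \<alpha> n r2 \<epsilon> by (intro mult_left_mono) auto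
      finally show ?thesis by simp
    qed
    have event: "{\<omega> \<in> space M. \<bar>Fe k \<omega> - Fg k \<omega> - (f (X k \<omega>) - f (X k \<omega> + \<Delta> k \<omega> *\<^sub>R G k \<omega>))\<bar>
        \<ge> \<alpha> * \<Delta> k \<omega> powr q} = {\<omega> \<in> space M. (\<omega>, \<Xi> \<omega>) \<in> B}"
      using Err_eq in_B by auto
    have "AE \<omega> in M. real_cond_exp M ?H (indicator {\<omega> \<in> space M. (\<omega>, \<Xi> \<omega>) \<in> B}) \<omega> \<le> \<epsilon> / \<alpha> powr r"
      using real_cond_exp_indicator_freeze[OF subalgebra_history \<Xi> indep_hist B] AE_space
    proof eventually_elim
      case (elim \<omega>)
      then show ?case using bound[of \<omega>] by simp
    qed
    then show "AE \<omega> in M. real_cond_exp M ?H (indicator {\<omega> \<in> space M.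
        \<bar>Fe k \<omega> - Fg k \<omega> - (f (X k \<omega>) - f (X k \<omega> + \<Delta> k \<omega> *\<^sub>R G k \<omega>))\<bar> \<ge> \<alpha> * \<Delta> k \<omega> powr q}) \<omega>
        \<le> \<epsilon> / \<alpha> powr (q / (q - 1))"
      unfolding event assms(8) .
  qed
  show ?thesis
  proof (intro exI[of _ p] exI[of _ \<epsilon>] conjI)
    show "\<forall>\<delta>>0. p \<delta> \<ge> 1" unfolding p_def using sample_size_pos by blast
    show "p \<in> borel \<rightarrow>\<^sub>M count_space UNIV" unfolding p_def by measurable
    show "(\<lambda>\<delta>. real (p \<delta>)) \<in> O[at_right 0](\<lambda>\<delta>. \<delta> powr (2 - 2 * q))"
      unfolding p_def by (rule sample_size_bigo[OF \<open>1 < q\<close>])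
    show "\<epsilon> > 0" by (rule \<epsilon>)
  qed (use tail in blast)
qed

end
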